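(* Let $(s,\pi)$ be a slope-level pair on a finite connected graph $G=(V,E)$ and $F$ a face of $\mathcal C_{s,\pi}$ intersecting $\mathbb R^E_{>0}$. Then there is a slope-level pair $(s',\pi')$ on $G$ such that $F=\mathcal C_{s',\pi'}=\sigma_{s',\pi'}$, and the following properties are verified: (F1) $\pi'$ is a coarsening of $\pi$; (F2) $s\le s'$; and (F3) $E^{\rm int}_{s'}\supseteq E^{\rm int}_s$. In particular, if $\mathring\sigma_{s,\pi}$ is nonempty, then each face of $\sigma_{s,\pi}$ intersecting $\mathbb R^E_{>0}$ is $\sigma_{s',\pi'}$ for some slope-level pair $(s',\pi')$ on $G$ satisfying (F1), (F2) and (F3).
   Context: Graphs. $\mathbb E$ is the set of arrows of $G$: each edge $\{u,v\}$ gives two arrows (also if a loop); $a=uv$ has tail $u$, head $v$, reverse $\bar a$. A circuit in a graph is a collection of arrows that can be ordered $a_1,\dots,a_k$ so that the head of $a_i$ is the tail of $a_{i+1}$ for $i<k$, the head of $a_k$ is the tail of $a_1$, and the tails of the $a_i$ are pairwise distinct. Slope-level pairs. A level structure $\pi$ on $G$ is a surjection from $V$ onto a totally ordered set $(V_\pi,\prec_\pi)$ (an ordered partition of $V$). $\pi'$ is a coarsening of $\pi$ if each part of $\pi$ is included in a part of $\pi'$ (compatibly with the orders). Edges joining vertices of the same level are horizontal for $\pi$, the others vertical. $A_\pi$ is the set of arrows $a=uv$ with $v\prec_\pi u$. A slope function is $s\colon\mathbb E\to\mathbb Z$ with $s(a)+s(\bar a)\in\{-1,0\}$ for all $a$;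 $A_s=\{a\mid s(\bar a)<0\}$; an edge is vertical for $s$ if one of its arrows is in $A_s$; an arrow or edge is integer for $s$ if $s(a)+s(\bar a)=0$; $E_s^{\rm int}$ is the set of integer vertical edges for $s$. $s\le s'$ means $s(a)\le s'(a)$ for all $a\in\mathbb E$. $(s,\pi)$ is a slope-level pair if $A_s=A_\pi$. Cones. For $\ell\in\mathbb R^E_{>0}$ and $h\colon V\to\mathbb R$, $s_h(a)=\lfloor(h(u)-h(v))/\ell_a\rfloor$ for $a=uv$, with $\ell_a$ the length of the edge underlying $a$; $\pi_h$ is the level structure whose parts are the fibers of $h$ ordered by value. $\mathring\sigma_{s,\pi}=\{\ell\in\mathbb R^E_{>0}\mid\exists h\colon V\to\mathbb R\text{ with }s_h=s,\ \pi_h=\pi\}$ and $\sigma_{s,\pi}$ is its closure in $\mathbb R^E_{\ge0}$. The cone $\mathcal C_{s,\pi}$. $G_\pi=(V_\pi,E_\pi)$ is obtained from $G$ by removing the horizontal edges for $\pi$ and identifying vertices of the same level. $G_\pi^\dagger$ is obtained from $G_\pi$ by adding one extra edge (a ghost edge) between any two distinct vertices. Extend $s$ to arrows on ghost edges by $s(uv)=-\infty$ if $u\prec_\pi v$ and $s(uv)=0$ otherwise; extend each $\ell\in\mathbb R^E_{\ge0}$ to ghost edges by $\ell_e=1$. $\mathcal C_{s,\pi}$ is the set of $\ell\in\mathbb R^E_{\ge0}$ with $\sum_{a\in q}\ell_as(a)\le0$ for all circuits $q$ in $G^\dagger_\pi$; it is a polyhedral cone. *)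

theory Defs
  imports
    "HOL-Analysis.Analysis"
    "Graph_Theory.Arc_Walk"
    "Graph_Theory.Bidirected_Digraph"
    "Graph_Theory.Digraph_Component"
begin

text \<open>
  An undirected multigraph, loops allowed, is given by its arrows: a \<open>pre_digraph\<close> \<open>G\<close> whose
  arcs are the arrows, with the arrow reversal \<open>arev\<close> of the locale \<open>bidirected_digraph\<close>. Since
  \<open>arev\<close> has no fixed point on \<open>arcs G\<close>, every edge, even a loop, has exactly two arrows.
  An edge is the set of its two arrows.
\<close>

definition edge :: "('b \<Rightarrow> 'b) \<Rightarrow> 'b \<Rightarrow> 'b set" where
  "edge arev a = {a, arev a}"

definition edges :: "('v, 'b) pre_digraph \<Rightarrow> ('b \<Rightarrow> 'b) \<Rightarrow> 'b set set" where
  "edges G arev = edge arev ` arcs G"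

text \<open>
  Edge lengths live in \<open>\<real>\<^sup>E\<close>, realised as the subspace of vectors of \<open>real ^ ('b set)\<close> supported on
  the set \<open>E\<close> of edges. The subspace is closed, so topological closures agree. Not all elements of
  \<open>'b\<close> need be arcs, so that a graph without edges is covered, too.
\<close>

definition nonneg_lengths :: "('v, 'b::finite) pre_digraph \<Rightarrow> ('b \<Rightarrow> 'b) \<Rightarrow> (real ^ ('b set)) set" where
  "nonneg_lengths G arev =
     {l. (\<forall>e\<in>edges G arev. 0 \<le> l $ e) \<and> (\<forall>e. e \<notin> edges G arev \<longrightarrow> l $ e = 0)}"

definition pos_lengths :: "('v, 'b::finite) pre_digraph \<Rightarrow> ('b \<Rightarrow> 'b) \<Rightarrow> (real ^ ('b set)) set" where
  "pos_lengths G arev =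
     {l. (\<forall>e\<in>edges G arev. 0 < l $ e) \<and> (\<forall>e. e \<notin> edges G arev \<longrightarrow> l $ e = 0)}"


text \<open>
  A level structure is an ordered partition \<open>(P, R)\<close> of the vertex set: \<open>P\<close> is the set of parts
  and \<open>R\<close> a (reflexive) linear order on \<open>P\<close>. The associated surjection sends a vertex to its part.
\<close>

type_synonym 'v levels = "'v set set \<times> ('v set \<times> 'v set) set"

definition level_structure :: "('v, 'b) pre_digraph \<Rightarrow> 'v levels \<Rightarrow> bool" where
  "level_structure G \<pi> \<longleftrightarrow> partition_on (verts G) (fst \<pi>) \<and> linear_order_on (fst \<pi>) (snd \<pi>)"

definition level :: "'v levels \<Rightarrow> 'v \<Rightarrow> 'v set" where
  "level \<pi> v = (THE p. p \<in> fst \<pi> \<and> v \<in> p)"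

definition level_less :: "'v levels \<Rightarrow> 'v set \<Rightarrow> 'v set \<Rightarrow> bool" where
  "level_less \<pi> p q \<longleftrightarrow> (p, q) \<in> snd \<pi> \<and> p \<noteq> q"

definition coarsening :: "'v levels \<Rightarrow> 'v levels \<Rightarrow> bool" where
  "coarsening \<pi>' \<pi> \<longleftrightarrow>
     (\<forall>p\<in>fst \<pi>. \<exists>p'\<in>fst \<pi>'. p \<subseteq> p') \<and>
     (\<forall>p q p' q'. (p, q) \<in> snd \<pi> \<and> p' \<in> fst \<pi>' \<and> q' \<in> fst \<pi>' \<and> p \<subseteq> p' \<and> q \<subseteq> q'
        \<longrightarrow> (p', q') \<in> snd \<pi>')"

definition A_level :: "('v, 'b) pre_digraph \<Rightarrow> 'v levels \<Rightarrow> 'b set" where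
  "A_level G \<pi> = {a \<in> arcs G. level_less \<pi> (level \<pi> (head G a)) (level \<pi> (tail G a))}"


text \<open>Only the values of slope functions on \<open>arcs G\<close> are relevant.\<close>

definition slope_function :: "('v, 'b) pre_digraph \<Rightarrow> ('b \<Rightarrow> 'b) \<Rightarrow> ('b \<Rightarrow> int) \<Rightarrow> bool" where
  "slope_function G arev s \<longleftrightarrow> (\<forall>a\<in>arcs G. s a + s (arev a) \<in> {-1, 0})"

definition A_slope :: "('v, 'b) pre_digraph \<Rightarrow> ('b \<Rightarrow> 'b) \<Rightarrow> ('b \<Rightarrow> int) \<Rightarrow> 'b set" where
  "A_slope G arev s = {a \<in> arcs G. s (arev a) < 0}"

definition integer_vertical_edges ::
    "('v, 'b) pre_digraph \<Rightarrow> ('b \<Rightarrow> 'b) \<Rightarrow> ('b \<Rightarrow> int) \<Rightarrow> 'b set set" where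
  "integer_vertical_edges G arev s =
     {edge arev a | a. a \<in> arcs G \<and> edge arev a \<inter> A_slope G arev s \<noteq> {} \<and> s a + s (arev a) = 0}"

definition slope_le :: "('v, 'b) pre_digraph \<Rightarrow> ('b \<Rightarrow> int) \<Rightarrow> ('b \<Rightarrow> int) \<Rightarrow> bool" where
  "slope_le G s s' \<longleftrightarrow> (\<forall>a\<in>arcs G. s a \<le> s' a)"

definition slope_level_pair ::
    "('v, 'b) pre_digraph \<Rightarrow> ('b \<Rightarrow> 'b) \<Rightarrow> ('b \<Rightarrow> int) \<Rightarrow> 'v levels \<Rightarrow> bool" where
  "slope_level_pair G arev s \<pi> \<longleftrightarrow>
     slope_function G arev s \<and> level_structure G \<pi> \<and> A_slope G arev s = A_level G \<pi>"


definition slope_of ::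
    "('v, 'b::finite) pre_digraph \<Rightarrow> ('b \<Rightarrow> 'b) \<Rightarrow> real ^ ('b set) \<Rightarrow> ('v \<Rightarrow> real) \<Rightarrow> 'b \<Rightarrow> int" where
  "slope_of G arev l h a = \<lfloor>(h (tail G a) - h (head G a)) / l $ edge arev a\<rfloor>"

definition fiber :: "('v, 'b) pre_digraph \<Rightarrow> ('v \<Rightarrow> real) \<Rightarrow> real \<Rightarrow> 'v set" where
  "fiber G h x = {v \<in> verts G. h v = x}"

definition levels_of :: "('v, 'b) pre_digraph \<Rightarrow> ('v \<Rightarrow> real) \<Rightarrow> 'v levels" where
  "levels_of G h =
     (fiber G h ` h ` verts G,
      {(fiber G h x, fiber G h y) | x y. x \<in> h ` verts G \<and> y \<in> h ` verts G \<and> x \<le> y})"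

definition open_sigma_cone ::
    "('v, 'b::finite) pre_digraph \<Rightarrow> ('b \<Rightarrow> 'b) \<Rightarrow> ('b \<Rightarrow> int) \<Rightarrow> 'v levels \<Rightarrow> (real ^ ('b set)) set" where
  "open_sigma_cone G arev s \<pi> =
     {l \<in> pos_lengths G arev. \<exists>h. (\<forall>a\<in>arcs G. slope_of G arev l h a = s a) \<and> levels_of G h = \<pi>}"

definition sigma_cone ::
    "('v, 'b::finite) pre_digraph \<Rightarrow> ('b \<Rightarrow> 'b) \<Rightarrow> ('b \<Rightarrow> int) \<Rightarrow> 'v levels \<Rightarrow> (real ^ ('b set)) set" where
  "sigma_cone G arev s \<pi> = closure (open_sigma_cone G arev s \<pi>)"


definition level_graph :: "('v, 'b) pre_digraph \<Rightarrow> 'v levels \<Rightarrow> ('v set, 'b) pre_digraph" where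
  "level_graph G \<pi> =
     \<lparr>verts = fst \<pi>,
      arcs = {a \<in> arcs G. level \<pi> (tail G a) \<noteq> level \<pi> (head G a)},
      tail = level \<pi> \<circ> tail G,
      head = level \<pi> \<circ> head G\<rparr>"

text \<open>
  The ghost edge between distinct levels \<open>p\<close> and \<open>q\<close> has the two arrows \<open>Inr (p, q)\<close>, from \<open>p\<close>
  to \<open>q\<close>, and \<open>Inr (q, p)\<close>.
\<close>

definition ghost_graph ::
    "('v, 'b) pre_digraph \<Rightarrow> 'v levels \<Rightarrow> ('v set, 'b + 'v set \<times> 'v set) pre_digraph" where
  "ghost_graph G \<pi> =
     \<lparr>verts = verts (level_graph G \<pi>),
      arcs = Inl ` arcs (level_graph G \<pi>) \<union> Inr ` {(p, q). p \<in> fst \<pi> \<and> q \<in> fst \<pi> \<and> p \<noteq> q},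
      tail = case_sum (tail (level_graph G \<pi>)) fst,
      head = case_sum (head (level_graph G \<pi>)) snd\<rparr>"

definition ext_slope :: "('b \<Rightarrow> int) \<Rightarrow> 'v levels \<Rightarrow> 'b + 'v set \<times> 'v set \<Rightarrow> ereal" where
  "ext_slope s \<pi> x =
     (case x of Inl a \<Rightarrow> ereal (real_of_int (s a))
      | Inr (p, q) \<Rightarrow> if level_less \<pi> p q then - \<infinity> else 0)"

definition ext_length ::
    "('b::finite \<Rightarrow> 'b) \<Rightarrow> real ^ ('b set) \<Rightarrow> 'b + 'v set \<times> 'v set \<Rightarrow> ereal" where
  "ext_length arev l x = (case x of Inl a \<Rightarrow> ereal (l $ edge arev a) | Inr _ \<Rightarrow> 1)"

text \<open>
  \<open>pre_digraph.cycle\<close> requires the heads, hence (the walk being closed) the tails, to be pairwise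
  distinct; loops and pairs of opposite arrows are allowed.
\<close>

definition circuits :: "('v, 'b) pre_digraph \<Rightarrow> 'b set set" where
  "circuits H = {set p | p. pre_digraph.cycle H p}"

definition cone_C ::
    "('v, 'b::finite) pre_digraph \<Rightarrow> ('b \<Rightarrow> 'b) \<Rightarrow> ('b \<Rightarrow> int) \<Rightarrow> 'v levels \<Rightarrow> (real ^ ('b set)) set" where
  "cone_C G arev s \<pi> =
     {l \<in> nonneg_lengths G arev.
        \<forall>q\<in>circuits (ghost_graph G \<pi>). (\<Sum>x\<in>q. ext_length arev l x * ext_slope s \<pi> x) \<le> 0}"

end

theory Submission
  imports Defs
begin

text \<open>
  By shortest-path duality, \<open>l\<close> lies in \<open>cone_C G arev s \<pi>\<close> iff it admits a potential: a function
  \<open>h\<close> on the vertices, monotone with respect to \<open>\<pi>\<close>, with \<open>l\<^sub>a s(a) \<le> h(u) - h(v)\<close> on every arrow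
  \<open>a = uv\<close>. The open cone consists of those \<open>l\<close> with a potential that is as strict as possible,
  and adding a small multiple of such a pair to any \<open>(l, h)\<close> shows that, if nonempty, it is dense
  in the cone. Given a face \<open>F\<close>, choose a positive \<open>l0\<close> in \<open>F\<close> with a potential \<open>h0\<close> making as few
  constraints tight as possible, and let \<open>s'\<close>, \<open>\<pi>'\<close> be the slopes and levels of \<open>(l0, h0)\<close>. The
  constraints tight at \<open>(l0, h0)\<close> are tight for all potentials of points of \<open>F\<close>, whence \<open>F\<close> lies in
  the cone of \<open>(s', \<pi>')\<close>. Conversely, a point \<open>l\<close> of that cone keeps all these constraints tight,
  so the segment from \<open>l\<close> to \<open>l0\<close> can be prolonged beyond \<open>l0\<close> inside the cone of \<open>(s, \<pi>)\<close>, and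
  \<open>l\<close> belongs to the face.
\<close>

section \<open>Potentials on weighted digraphs\<close>

context wf_digraph
begin

text \<open>The differences telescope along the walk. On a closed walk the bound is 0, which is the
  easy half of the duality.\<close>

lemma sum_list_awalk_le_potential:
  fixes w :: "'b \<Rightarrow> real" and f :: "'a \<Rightarrow> real"
  assumes "\<And>a. a \<in> arcs G \<inter> A \<Longrightarrow> w a \<le> f (tail G a) - f (head G a)"
    and "awalk u p v" and "set p \<subseteq> A"
  shows "sum_list (map w p) \<le> f u - f v"
  using assms(2,3)
proof (induction p arbitrary: u)
  case Nil
  then show ?case by (simp add: awalk_Nil_iff)
next
  case (Cons a p)
  then have "a \<in> arcs G \<inter> A" "u = tail G a" "awalk (head G a) p v" "set p \<subseteq> A"
    by (auto simp: awalk_Cons_iff)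
  with Cons.IH[of "head G a"] assms(1)[of a] show ?case by simp
qed

end

text \<open>
  The potential of a vertex is the largest weight of a simple path starting there. Prepending an
  arc \<open>a\<close> to an optimal path from the head of \<open>a\<close> either gives another simple path or closes a
  cycle, which can be dropped since it has weight at most \<open>0\<close>.
\<close>

lemma (in fin_digraph) potential_exists:
  fixes w :: "'b \<Rightarrow> real"
  assumes nonpos: "\<And>p. cycle p \<Longrightarrow> set p \<subseteq> A \<Longrightarrow> sum_list (map w p) \<le> 0"
  obtains f :: "'a \<Rightarrow> real"
    where "\<And>a. a \<in> arcs G \<inter> A \<Longrightarrow> w a \<le> f (tail G a) - f (head G a)"
proof -
  define W where "W v = {sum_list (map w p) | p x. apath v p x \<and> set p \<subseteq> A}" for v
  define f where "f v = Max (W v)" for v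
  have fin: "finite (W v)" for v
  proof -
    have "W v \<subseteq> (\<lambda>(u, p, x). sum_list (map w p)) ` {(u, p, x). apath u p x}"
      by (force simp: W_def)
    then show ?thesis using apaths_finite_triple finite_surj by blast
  qed
  have upper: "sum_list (map w p) \<le> f v" if "apath v p x" "set p \<subseteq> A" for v p x
    unfolding f_def by (rule Max_ge[OF fin]) (use that in \<open>auto simp: W_def\<close>)
  have "w a \<le> f (tail G a) - f (head G a)" if a: "a \<in> arcs G \<inter> A" for a
  proof -
    \<comment> \<open>The empty path keeps this finite set of weights nonempty, so its maximum is
      attained by some path.\<close>
    have "0 \<in> W (head G a)"
      unfolding W_def using a by (auto simp: apath_Nil_iff intro!: exI[of _ "[]"])
    then have "f (head G a) \<in> W (head G a)"
      unfolding f_def using fin by (intro Max_in) auto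
    then obtain p x where p: "apath (head G a) p x" "set p \<subseteq> A"
      and f: "f (head G a) = sum_list (map w p)"
      by (auto simp: W_def)
    show ?thesis
    proof (cases "tail G a \<in> set (awalk_verts (head G a) p)")
      case False
      then have "apath (tail G a) (a # p) x"
        using p a by (auto simp: apath_Cons_iff)
      from upper[OF this] p a f show ?thesis by auto
    next
      case True
      \<comment> \<open>The optimal path is cut where it meets the tail of \<open>a\<close>:
        \<open>a # q\<close> closes up to a cycle (\<open>q\<close> is empty if \<open>a\<close> is
        a loop), and \<open>r\<close> competes for the maximum \<open>f (tail G a)\<close>.\<close>
      then obtain q r where qr: "p = q @ r" "awalk (head G a) q (tail G a)"
        using awalk_decomp[OF awalkI_apath[OF p(1)]] by blast
      then have last: "awlast (head G a) q = tail G a" by auto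
      with p(1) qr(1) have paths: "apath (head G a) q (tail G a)" "apath (tail G a) r x"
        by (simp_all add: apath_append_iff)
      then have "cycle (a # q)"
        unfolding cycle_def using a
        by (auto simp: apath_def awalk_Cons_iff intro!: exI[of _ "tail G a"])
      with nonpos[of "a # q"] p qr a have "w a + sum_list (map w q) \<le> 0" by auto
      moreover have "sum_list (map w r) \<le> f (tail G a)"
        using upper[OF paths(2)] p qr by auto
      ultimately show ?thesis using f qr by simp
    qed
  qed
  then show ?thesis by (rule that)
qed

section \<open>Levels\<close>

lemma level_eq:
  assumes "level_structure G \<pi>" "p \<in> fst \<pi>" "v \<in> p"
  shows "level \<pi> v = p"
  unfolding level_def
proof (rule the_equality)
  fix q assume "q \<in> fst \<pi> \<and> v \<in> q"
  with assms show "q = p"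
    by (auto simp: level_structure_def partition_on_def disjoint_def)
qed (use assms in auto)

lemma level_mem:
  assumes "level_structure G \<pi>" "v \<in> verts G"
  shows "level \<pi> v \<in> fst \<pi>" "v \<in> level \<pi> v"
proof -
  obtain p where "p \<in> fst \<pi>" "v \<in> p"
    using assms by (auto simp: level_structure_def partition_on_def)
  with level_eq[OF assms(1) this] show "level \<pi> v \<in> fst \<pi>" "v \<in> level \<pi> v" by auto
qed

lemma level_part:
  assumes "level_structure G \<pi>" "p \<in> fst \<pi>"
  obtains v where "v \<in> verts G" "v \<in> p" "level \<pi> v = p"
proof -
  have "p \<noteq> {}" "p \<subseteq> verts G"
    using assms by (auto simp: level_structure_def partition_on_def)
  then obtain v where "v \<in> verts G" "v \<in> p" by blast
  then show ?thesis using that level_eq[OF assms] by blast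
qed

lemma level_le_refl: "level_structure G \<pi> \<Longrightarrow> p \<in> fst \<pi> \<Longrightarrow> (p, p) \<in> snd \<pi>"
  by (auto simp: level_structure_def order_on_defs refl_on_def)

lemma level_le_antisym:
  "level_structure G \<pi> \<Longrightarrow> (p, q) \<in> snd \<pi> \<Longrightarrow> (q, p) \<in> snd \<pi> \<Longrightarrow> p = q"
  unfolding level_structure_def order_on_defs antisym_def by blast

lemma level_le_total:
  "level_structure G \<pi> \<Longrightarrow> p \<in> fst \<pi> \<Longrightarrow> q \<in> fst \<pi> \<Longrightarrow> (p, q) \<in> snd \<pi> \<or> (q, p) \<in> snd \<pi>"
  unfolding level_structure_def order_on_defs refl_on_def total_on_def by metis

lemma level_le_part:
  "level_structure G \<pi> \<Longrightarrow> (p, q) \<in> snd \<pi> \<Longrightarrow> p \<in> fst \<pi> \<and> q \<in> fst \<pi>"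
  unfolding level_structure_def order_on_defs by blast

section \<open>The ordered partition into the fibers of a real function\<close>

lemma levels_of_fiber_le_iff:
  assumes "x \<in> h ` verts G" "y \<in> h ` verts G"
  shows "(fiber G h x, fiber G h y) \<in> snd (levels_of G h) \<longleftrightarrow> x \<le> y"
proof
  \<comment> \<open>A fiber over an attained value is nonempty and so determines that value.\<close>
  have inj: "x' = y'" if "fiber G h x' = fiber G h y'" "x' \<in> h ` verts G" for x' y'
    using that by (auto simp: fiber_def)
  assume "(fiber G h x, fiber G h y) \<in> snd (levels_of G h)"
  then obtain x' y' where "fiber G h x = fiber G h x'" "fiber G h y = fiber G h y'" "x' \<le> y'"
    by (auto simp: levels_of_def)
  moreover have "x = x'" by (rule inj) fact+
  moreover have "y = y'" by (rule inj) fact+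
  ultimately show "x \<le> y" by simp
qed (use assms in \<open>auto simp: levels_of_def\<close>)

lemma level_structure_levels_of: "level_structure G (levels_of G h)"
proof -
  note le = levels_of_fiber_le_iff[of _ h G]
  have ne: "fiber G h x \<noteq> {}" if "x \<in> h ` verts G" for x
    using that by (auto simp: fiber_def)
  have fst: "fst (levels_of G h) = fiber G h ` h ` verts G" by (simp add: levels_of_def)
  have sub: "snd (levels_of G h) \<subseteq> fst (levels_of G h) \<times> fst (levels_of G h)"
    by (auto simp: levels_of_def)
  have part: "\<exists>x \<in> h ` verts G. p = fiber G h x"
    if "(p, q) \<in> snd (levels_of G h) \<or> (q, p) \<in> snd (levels_of G h)" for p q
    using that sub by (auto simp: fst)
  have "\<Union> (fst (levels_of G h)) = verts G" by (auto simp: fst fiber_def)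
  moreover have "disjoint (fst (levels_of G h))"
    by (auto simp: disjoint_def fst fiber_def)
  moreover have "{} \<notin> fst (levels_of G h)" unfolding fst using ne by blast
  moreover have "refl_on (fst (levels_of G h)) (snd (levels_of G h))"
    by (auto simp: refl_on_def fst le)
  moreover have "total_on (fst (levels_of G h)) (snd (levels_of G h))"
    by (auto simp: total_on_def fst le)
  moreover have "trans (snd (levels_of G h))"
  proof (rule transI)
    fix p q r assume *: "(p, q) \<in> snd (levels_of G h)" "(q, r) \<in> snd (levels_of G h)"
    obtain x where x: "x \<in> h ` verts G" "p = fiber G h x" using part *(1) by blast
    obtain y where y: "y \<in> h ` verts G" "q = fiber G h y" using part *(1) by blast
    obtain z where z: "z \<in> h ` verts G" "r = fiber G h z" using part *(2) by blast
    show "(p, r) \<in> snd (levels_of G h)"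
      using * le[OF x(1) y(1)] le[OF y(1) z(1)] le[OF x(1) z(1)]
      unfolding x(2) y(2) z(2) by simp
  qed
  moreover have "antisym (snd (levels_of G h))"
  proof (rule antisymI)
    fix p q assume *: "(p, q) \<in> snd (levels_of G h)" "(q, p) \<in> snd (levels_of G h)"
    obtain x where x: "x \<in> h ` verts G" "p = fiber G h x" using part *(1) by blast
    obtain y where y: "y \<in> h ` verts G" "q = fiber G h y" using part *(1) by blast
    show "p = q"
      using * le[OF x(1) y(1)] le[OF y(1) x(1)] unfolding x(2) y(2) by simp
  qed
  ultimately show ?thesis
    using sub by (simp add: level_structure_def partition_on_def order_on_defs)
qed

lemma level_levels_of:
  assumes "v \<in> verts G"
  shows "level (levels_of G h) v = fiber G h (h v)"
  using assms by (intro level_eq[OF level_structure_levels_of]) (auto simp: levels_of_def fiber_def)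

lemma levels_of_le_iff:
  assumes "u \<in> verts G" "v \<in> verts G"
  shows "(level (levels_of G h) u, level (levels_of G h) v) \<in> snd (levels_of G h) \<longleftrightarrow> h u \<le> h v"
  using assms by (simp add: level_levels_of levels_of_fiber_le_iff)

lemma levels_of_eq_iff:
  assumes "u \<in> verts G" "v \<in> verts G"
  shows "level (levels_of G h) u = level (levels_of G h) v \<longleftrightarrow> h u = h v"
proof
  assume "level (levels_of G h) u = level (levels_of G h) v"
  moreover have "u \<in> level (levels_of G h) u"
    using assms by (simp add: level_levels_of fiber_def)
  ultimately have "u \<in> fiber G h (h v)" using assms by (simp add: level_levels_of)
  then show "h u = h v" by (simp add: fiber_def)
qed (use assms in \<open>simp add: level_levels_of\<close>)

text \<open>An ordered partition is determined by the total preorder it induces on the vertices: its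
  parts are the equivalence classes, and their order can be read off from representatives.\<close>

lemma level_structure_eqI:
  fixes \<pi> \<rho> :: "'a levels"
  assumes \<pi>: "level_structure G \<pi>" and \<rho>: "level_structure G \<rho>"
    and le: "\<And>u v. u \<in> verts G \<Longrightarrow> v \<in> verts G \<Longrightarrow>
      (level \<pi> u, level \<pi> v) \<in> snd \<pi> \<longleftrightarrow> (level \<rho> u, level \<rho> v) \<in> snd \<rho>"
  shows "\<pi> = \<rho>"
proof -
  have part: "level \<sigma> u =
      {v \<in> verts G. (level \<sigma> u, level \<sigma> v) \<in> snd \<sigma> \<and> (level \<sigma> v, level \<sigma> u) \<in> snd \<sigma>}"
    if \<sigma>: "level_structure G \<sigma>" and u: "u \<in> verts G" for \<sigma> u
  proof (rule set_eqI)
    fix v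
    have 1: "v \<in> verts G \<and> level \<sigma> v = level \<sigma> u" if "v \<in> level \<sigma> u"
      using \<sigma> level_mem[OF \<sigma> u] that level_eq[OF \<sigma> _ that]
      by (auto simp: level_structure_def partition_on_def)
    have 2: "v \<in> level \<sigma> u"
      if "v \<in> verts G" "(level \<sigma> u, level \<sigma> v) \<in> snd \<sigma>" "(level \<sigma> v, level \<sigma> u) \<in> snd \<sigma>"
      using level_mem(2)[OF \<sigma> that(1)] level_le_antisym[OF \<sigma> that(2,3)] by simp
    show "v \<in> level \<sigma> u \<longleftrightarrow>
        v \<in> {v \<in> verts G. (level \<sigma> u, level \<sigma> v) \<in> snd \<sigma> \<and> (level \<sigma> v, level \<sigma> u) \<in> snd \<sigma>}"
      using 1 2 level_le_refl[OF \<sigma> level_mem(1)[OF \<sigma> u]] by auto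
  qed
  have lev: "level \<pi> u = level \<rho> u" if u: "u \<in> verts G" for u
  proof -
    note part[OF \<pi> u]
    also have "{v \<in> verts G. (level \<pi> u, level \<pi> v) \<in> snd \<pi> \<and> (level \<pi> v, level \<pi> u) \<in> snd \<pi>} =
        {v \<in> verts G. (level \<rho> u, level \<rho> v) \<in> snd \<rho> \<and> (level \<rho> v, level \<rho> u) \<in> snd \<rho>}"
      using le u by auto
    also note part[OF \<rho> u, symmetric]
    finally show ?thesis .
  qed
  have fst_subset: "fst \<sigma> \<subseteq> fst \<tau>"
    if \<sigma>: "level_structure G \<sigma>" and \<tau>: "level_structure G \<tau>"
      and eq: "\<And>u. u \<in> verts G \<Longrightarrow> level \<sigma> u = level \<tau> u" for \<sigma> \<tau> :: "'a levels"
  proof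
    fix p assume "p \<in> fst \<sigma>"
    then obtain v where "v \<in> verts G" "level \<sigma> v = p" by (rule level_part[OF \<sigma>])
    then show "p \<in> fst \<tau>" using level_mem(1)[OF \<tau>] eq by metis
  qed
  have snd_subset: "snd \<sigma> \<subseteq> snd \<tau>"
    if \<sigma>: "level_structure G \<sigma>"
      and eq: "\<And>u. u \<in> verts G \<Longrightarrow> level \<sigma> u = level \<tau> u"
      and le: "\<And>u v. u \<in> verts G \<Longrightarrow> v \<in> verts G \<Longrightarrow>
        (level \<sigma> u, level \<sigma> v) \<in> snd \<sigma> \<longleftrightarrow> (level \<tau> u, level \<tau> v) \<in> snd \<tau>" for \<sigma> \<tau> :: "'a levels"
  proof (rule subrelI)
    fix p q assume pq: "(p, q) \<in> snd \<sigma>"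
    then have "p \<in> fst \<sigma>" "q \<in> fst \<sigma>" using level_le_part[OF \<sigma>] by auto
    obtain u where "u \<in> verts G" "level \<sigma> u = p" by (rule level_part[OF \<sigma> \<open>p \<in> fst \<sigma>\<close>])
    moreover obtain v where "v \<in> verts G" "level \<sigma> v = q" by (rule level_part[OF \<sigma> \<open>q \<in> fst \<sigma>\<close>])
    ultimately show "(p, q) \<in> snd \<tau>" using pq le[of u v] eq[of u] eq[of v] by simp
  qed
  show ?thesis
  proof (intro prod_eqI equalityI)
    show "fst \<pi> \<subseteq> fst \<rho>" by (rule fst_subset[OF \<pi> \<rho> lev])
    show "fst \<rho> \<subseteq> fst \<pi>" by (rule fst_subset[OF \<rho> \<pi> lev[symmetric]])
    show "snd \<pi> \<subseteq> snd \<rho>" by (rule snd_subset[OF \<pi> lev le])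
    show "snd \<rho> \<subseteq> snd \<pi>" by (rule snd_subset[OF \<rho> lev[symmetric] le[symmetric]])
  qed
qed

lemma levels_of_eqI:
  assumes "level_structure G \<pi>"
    and "\<And>u v. u \<in> verts G \<Longrightarrow> v \<in> verts G \<Longrightarrow>
      (level \<pi> u, level \<pi> v) \<in> snd \<pi> \<longleftrightarrow> h u \<le> h v"
  shows "levels_of G h = \<pi>"
  by (rule level_structure_eqI[OF level_structure_levels_of assms(1)])
    (simp add: levels_of_le_iff assms(2))

text \<open>Within one part monotonicity applies in both directions, so \<open>h\<close> is constant
  there and the part lies in a single fiber. This is the source of (F1).\<close>

lemma coarsening_levels_of:
  assumes \<pi>: "level_structure G \<pi>"
    and mono: "\<And>u v. u \<in> verts G \<Longrightarrow> v \<in> verts G \<Longrightarrow> (level \<pi> u, level \<pi> v) \<in> snd \<pi> \<Longrightarrow> h u \<le> h v"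
  shows "coarsening (levels_of G h) \<pi>"
proof -
  have sub: "p \<subseteq> verts G" if "p \<in> fst \<pi>" for p
    using \<pi> that by (auto simp: level_structure_def partition_on_def)
  have same: "h u = h v" if "p \<in> fst \<pi>" "u \<in> p" "v \<in> p" for p u v
    using mono[of u v] mono[of v u] sub[OF that(1)] level_le_refl[OF \<pi>] that
    by (auto simp: level_eq[OF \<pi>] intro!: antisym)
  have "\<exists>p'\<in>fst (levels_of G h). p \<subseteq> p'" if p: "p \<in> fst \<pi>" for p
  proof -
    obtain v where v: "v \<in> verts G" "v \<in> p" by (rule level_part[OF \<pi> p])
    have "u \<in> fiber G h (h v)" if "u \<in> p" for u
      using same[OF p that v(2)] sub[OF p] that by (auto simp: fiber_def)
    moreover have "fiber G h (h v) \<in> fst (levels_of G h)"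
      using v by (simp add: levels_of_def)
    ultimately have "fiber G h (h v) \<in> fst (levels_of G h)" "p \<subseteq> fiber G h (h v)" by auto
    then show ?thesis by blast
  qed
  moreover have "(p', q') \<in> snd (levels_of G h)"
    if "(p, q) \<in> snd \<pi>" "p' \<in> fst (levels_of G h)" "q' \<in> fst (levels_of G h)" "p \<subseteq> p'" "q \<subseteq> q'"
    for p q p' q'
  proof -
    have pq: "p \<in> fst \<pi>" "q \<in> fst \<pi>" using level_le_part[OF \<pi>] that by auto
    obtain u where u: "u \<in> verts G" "u \<in> p" "level \<pi> u = p" by (rule level_part[OF \<pi> pq(1)])
    obtain v where v: "v \<in> verts G" "v \<in> q" "level \<pi> v = q" by (rule level_part[OF \<pi> pq(2)])
    have "h u \<le> h v" using mono u v that by simp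
    moreover have "level (levels_of G h) u = p'"
      by (rule level_eq[OF level_structure_levels_of that(2) subsetD[OF that(4) u(2)]])
    moreover have "level (levels_of G h) v = q'"
      by (rule level_eq[OF level_structure_levels_of that(3) subsetD[OF that(5) v(2)]])
    ultimately show ?thesis using levels_of_le_iff[OF u(1) v(1), of h] by simp
  qed
  ultimately show ?thesis by (auto simp: coarsening_def)
qed

lemma (in bidirected_digraph) edge_arev [simp]: "edge arev (arev a) = edge arev a"
  by (auto simp: edge_def)

text \<open>The sum of the floors of \<open>x\<close> and \<open>- x\<close> is 0 if
  \<open>x\<close> is an integer and -1 otherwise. A floor is negative iff its argument is, so the
  signs of the slopes compare heights.\<close>

lemma slope_level_pair_slope_of:
  assumes "bidirected_digraph G arev" and l: "l \<in> pos_lengths G arev"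
  shows "slope_level_pair G arev (slope_of G arev l h) (levels_of G h)"
proof -
  interpret bidirected_digraph G arev by fact
  have pos: "0 < l $ edge arev a" if "a \<in> arcs G" for a
    using l that by (auto simp: pos_lengths_def edges_def)
  have "slope_of G arev l h a + slope_of G arev l h (arev a) \<in> {-1, 0}" if "a \<in> arcs G" for a
  proof -
    define x where "x = (h (tail G a) - h (head G a)) / l $ edge arev a"
    have "slope_of G arev l h a = \<lfloor>x\<rfloor>" by (simp add: slope_of_def x_def)
    moreover have "slope_of G arev l h (arev a) = \<lfloor>- x\<rfloor>"
      using that by (simp add: slope_of_def x_def minus_divide_left)
    moreover have "\<lfloor>x\<rfloor> + \<lfloor>- x\<rfloor> = -1 \<or> \<lfloor>x\<rfloor> + \<lfloor>- x\<rfloor> = 0" by linarith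
    ultimately show ?thesis by auto
  qed
  moreover have "slope_of G arev l h (arev a) < 0 \<longleftrightarrow>
      level_less (levels_of G h) (level (levels_of G h) (head G a)) (level (levels_of G h) (tail G a))"
    if a: "a \<in> arcs G" for a
  proof -
    have "slope_of G arev l h (arev a) < 0 \<longleftrightarrow> h (head G a) < h (tail G a)"
      using a pos[OF a] by (simp add: slope_of_def divide_less_0_iff)
    also have "\<dots> \<longleftrightarrow> level_less (levels_of G h)
        (level (levels_of G h) (head G a)) (level (levels_of G h) (tail G a))"
      using a by (simp add: level_less_def levels_of_le_iff levels_of_eq_iff less_le)
    finally show ?thesis .
  qed
  ultimately show ?thesis
    using level_structure_levels_of
    by (auto simp: slope_level_pair_def slope_function_def A_slope_def A_level_def)
qed

section \<open>The cone as a set of lengths admitting a potential\<close>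

text \<open>
  A circuit through a ghost arrow outside this set has weight \<open>-\<infinity>\<close> and imposes no condition.
\<close>

definition not_ascending :: "'v levels \<Rightarrow> ('b + 'v set \<times> 'v set) set" where
  "not_ascending \<pi> = {x. \<forall>p q. x = Inr (p, q) \<longrightarrow> \<not> level_less \<pi> p q}"

text \<open>A real-valued stand-in for the product of extended length and slope. The two agree on
  \<open>not_ascending \<pi>\<close>; they differ on ascending ghost arrows, where the product is
  -\<infinity>.\<close>

definition arrow_weight ::
    "('b::finite \<Rightarrow> 'b) \<Rightarrow> ('b \<Rightarrow> int) \<Rightarrow> real ^ ('b set) \<Rightarrow> 'b + 'v set \<times> 'v set \<Rightarrow> real" where
  "arrow_weight arev s l x = (case x of Inl a \<Rightarrow> l $ edge arev a * of_int (s a) | Inr _ \<Rightarrow> 0)"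

text \<open>No term is +\<infinity>, so a single ascending ghost arrow makes the whole sum
  -\<infinity>. Without one, all terms are finite.\<close>

lemma ext_sum_nonpos_iff:
  assumes "finite q"
  shows "(\<Sum>x\<in>q. ext_length arev l x * ext_slope s \<pi> x) \<le> 0 \<longleftrightarrow>
    (q \<subseteq> not_ascending \<pi> \<longrightarrow> (\<Sum>x\<in>q. arrow_weight arev s l x) \<le> 0)"
proof (cases "q \<subseteq> not_ascending \<pi>")
  case True
  have "ext_length arev l x * ext_slope s \<pi> x = ereal (arrow_weight arev s l x)" if "x \<in> q" for x
    using that True
    by (auto simp: ext_length_def ext_slope_def arrow_weight_def not_ascending_def split: sum.split)
  then have "(\<Sum>x\<in>q. ext_length arev l x * ext_slope s \<pi> x) =
      ereal (\<Sum>x\<in>q. arrow_weight arev s l x)"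
    by simp
  with True show ?thesis by simp
next
  case False
  then obtain x where x: "x \<in> q" "x \<notin> not_ascending \<pi>" by blast
  define f where "f x = ext_length arev l x * ext_slope s \<pi> x" for x
  have "f x = -\<infinity>"
    using x by (auto simp: f_def ext_length_def ext_slope_def not_ascending_def)
  moreover have "f y \<noteq> \<infinity>" for y
    by (auto simp: f_def ext_length_def ext_slope_def split: sum.split)
  then have "sum f (q - {x}) \<noteq> \<infinity>" by (auto simp: sum_Pinfty)
  ultimately have "sum f q = -\<infinity>"
    using assms x by (simp add: sum.remove)
  with False show ?thesis by (simp add: f_def)
qed

lemma fin_digraph_ghost_graph:
  assumes "fin_digraph G" and \<pi>: "level_structure G \<pi>"
  shows "fin_digraph (ghost_graph G \<pi>)"
proof -
  interpret fin_digraph G by fact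
  have fin: "finite (fst \<pi>)"
    using \<pi> finite_verts by (auto simp: level_structure_def partition_on_def intro: finite_UnionD)
  show ?thesis
  proof
    fix e assume "e \<in> arcs (ghost_graph G \<pi>)"
    then show "tail (ghost_graph G \<pi>) e \<in> verts (ghost_graph G \<pi>)"
      and "head (ghost_graph G \<pi>) e \<in> verts (ghost_graph G \<pi>)"
      using level_mem(1)[OF \<pi>] by (auto simp: ghost_graph_def level_graph_def)
  next
    have "finite {(p, q). p \<in> fst \<pi> \<and> q \<in> fst \<pi> \<and> p \<noteq> q}"
      by (rule finite_subset[of _ "fst \<pi> \<times> fst \<pi>"]) (use fin in auto)
    then show "finite (arcs (ghost_graph G \<pi>))"
      by (simp add: ghost_graph_def level_graph_def)
  qed (simp add: ghost_graph_def level_graph_def fin)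
qed

text \<open>
  Two vertices of the same level contribute both pairs, so that potentials are constant on levels.
\<close>

definition constraints :: "('v, 'b) pre_digraph \<Rightarrow> 'v levels \<Rightarrow> ('b + 'v \<times> 'v) set" where
  "constraints G \<pi> =
     arcs G <+> {(u, v). u \<in> verts G \<and> v \<in> verts G \<and> (level \<pi> u, level \<pi> v) \<in> snd \<pi>}"

definition slack ::
    "('v, 'b::finite) pre_digraph \<Rightarrow> ('b \<Rightarrow> 'b) \<Rightarrow> ('b \<Rightarrow> int) \<Rightarrow> real ^ ('b set) \<Rightarrow> ('v \<Rightarrow> real) \<Rightarrow>
      'b + 'v \<times> 'v \<Rightarrow> real" where
  "slack G arev s l h i =
     (case i of Inl a \<Rightarrow> h (tail G a) - h (head G a) - l $ edge arev a * of_int (s a)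
      | Inr (u, v) \<Rightarrow> h v - h u)"

definition potential ::
    "('v, 'b::finite) pre_digraph \<Rightarrow> ('b \<Rightarrow> 'b) \<Rightarrow> ('b \<Rightarrow> int) \<Rightarrow> 'v levels \<Rightarrow> real ^ ('b set) \<Rightarrow>
      ('v \<Rightarrow> real) \<Rightarrow> bool" where
  "potential G arev s \<pi> l h \<longleftrightarrow> (\<forall>i\<in>constraints G \<pi>. 0 \<le> slack G arev s l h i)"

text \<open>Joint linearity in lengths and heights. The coefficients may be negative, so it serves
  both for midpoints and for prolonging a segment beyond an endpoint.\<close>

lemma slack_combination:
  "slack G arev s (c *\<^sub>R l + d *\<^sub>R l') (\<lambda>v. c * h v + d * h' v) i =
     c * slack G arev s l h i + d * slack G arev s l' h' i"
  by (auto simp: slack_def algebra_simps split: sum.split)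

lemma potential_arrow:
  "potential G arev s \<pi> l h \<Longrightarrow> a \<in> arcs G \<Longrightarrow>
     l $ edge arev a * of_int (s a) \<le> h (tail G a) - h (head G a)"
  by (force simp: potential_def constraints_def slack_def)

lemma potential_mono:
  "potential G arev s \<pi> l h \<Longrightarrow> u \<in> verts G \<Longrightarrow> v \<in> verts G \<Longrightarrow>
     (level \<pi> u, level \<pi> v) \<in> snd \<pi> \<Longrightarrow> h u \<le> h v"
  by (force simp: potential_def constraints_def slack_def)

lemma potentialI:
  assumes "\<And>a. a \<in> arcs G \<Longrightarrow> l $ edge arev a * of_int (s a) \<le> h (tail G a) - h (head G a)"
    and "\<And>u v. u \<in> verts G \<Longrightarrow> v \<in> verts G \<Longrightarrow> (level \<pi> u, level \<pi> v) \<in> snd \<pi> \<Longrightarrow> h u \<le> h v"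
  shows "potential G arev s \<pi> l h"
  using assms by (auto simp: potential_def constraints_def slack_def)

lemma finite_constraints: "fin_digraph G \<Longrightarrow> finite (constraints G \<pi>)"
  unfolding constraints_def
  by (intro finite_Plus finite_subset[of "{(u, v). _ u v}" "verts G \<times> verts G"])
    (auto simp: fin_digraph.finite_arcs fin_digraph.finite_verts)

section \<open>Slope-level pairs and the duality between circuits and potentials\<close>

locale slope_levels = bidirected_digraph G arev + fin_digraph G
  for G :: "('v, 'b::finite) pre_digraph" and arev +
  fixes s :: "'b \<Rightarrow> int" and \<pi> :: "'v levels"
  assumes slope_level_pair: "slope_level_pair G arev s \<pi>"
begin

lemma level_structure: "level_structure G \<pi>"
  using slope_level_pair by (simp add: slope_level_pair_def)

lemma slope_sum:
  assumes "a \<in> arcs G"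
  shows "s a + s (arev a) \<le> 0" "-1 \<le> s a + s (arev a)"
proof -
  have "s a + s (arev a) \<in> {-1, 0}"
    using slope_level_pair assms unfolding slope_level_pair_def slope_function_def by blast
  then show "s a + s (arev a) \<le> 0" "-1 \<le> s a + s (arev a)" by auto
qed

lemma slope_neg_iff:
  assumes "a \<in> arcs G"
  shows "s (arev a) < 0 \<longleftrightarrow> level_less \<pi> (level \<pi> (head G a)) (level \<pi> (tail G a))"
  using slope_level_pair assms by (auto simp: slope_level_pair_def A_slope_def A_level_def)

text \<open>Neither the arrow nor its reverse has negative slope, and their sum is at most 0. This
  is why dropping horizontal edges from the ghost graph loses no constraint.\<close>

lemma slope_horizontal:
  assumes "a \<in> arcs G" "level \<pi> (tail G a) = level \<pi> (head G a)"
  shows "s a = 0"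
proof -
  have "\<not> s (arev a) < 0" "\<not> s a < 0"
    using slope_neg_iff[of a] slope_neg_iff[of "arev a"] assms by (auto simp: level_less_def)
  then show ?thesis using slope_sum[OF assms(1)] by simp
qed

sublocale ghost: fin_digraph "ghost_graph G \<pi>"
  by (rule fin_digraph_ghost_graph[OF _ level_structure]) unfold_locales

text \<open>A cycle repeats no arc, so summing over the circuit as a set is summing along the
  walk.\<close>

lemma cone_C_eq:
  "cone_C G arev s \<pi> =
     {l \<in> nonneg_lengths G arev. \<forall>p. ghost.cycle p \<longrightarrow> set p \<subseteq> not_ascending \<pi> \<longrightarrow>
        sum_list (map (arrow_weight arev s l) p) \<le> 0}"
proof -
  have "(\<Sum>x\<in>set p. arrow_weight arev s l x) = sum_list (map (arrow_weight arev s l) p)"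
    if "ghost.cycle p" for l p
    using that by (auto simp: ghost.cycle_conv sum_list_distinct_conv_sum_set)
  then show ?thesis
    unfolding cone_C_def circuits_def by (auto simp: ext_sum_nonpos_iff)
qed

text \<open>A potential on the ghost graph pulls back along \<open>level \<pi>\<close>, the ghost
  arrows giving monotonicity. Conversely, a potential descends to levels, and telescoping bounds the
  weight of every cycle.\<close>

lemma mem_cone_C_iff:
  "l \<in> cone_C G arev s \<pi> \<longleftrightarrow> l \<in> nonneg_lengths G arev \<and> (\<exists>h. potential G arev s \<pi> l h)"
proof (intro iffI conjI; (elim conjE exE)?)
  assume l: "l \<in> cone_C G arev s \<pi>"
  then show "l \<in> nonneg_lengths G arev" by (simp add: cone_C_eq)
  obtain f where f: "\<And>x. x \<in> arcs (ghost_graph G \<pi>) \<inter> not_ascending \<pi> \<Longrightarrow>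
      arrow_weight arev s l x \<le> f (tail (ghost_graph G \<pi>) x) - f (head (ghost_graph G \<pi>) x)"
    by (rule ghost.potential_exists[of "not_ascending \<pi>" "arrow_weight arev s l"])
      (use l in \<open>auto simp: cone_C_eq\<close>)
  have "potential G arev s \<pi> l (\<lambda>v. f (level \<pi> v))"
  proof (rule potentialI)
    fix a assume a: "a \<in> arcs G"
    show "l $ edge arev a * of_int (s a) \<le> f (level \<pi> (tail G a)) - f (level \<pi> (head G a))"
    proof (cases "level \<pi> (tail G a) = level \<pi> (head G a)")
      case True
      then show ?thesis using slope_horizontal[OF a] by simp
    next
      case False
      then show ?thesis
        using f[of "Inl a"] a
        by (simp add: ghost_graph_def level_graph_def not_ascending_def arrow_weight_def)
    qed
  next
    fix u v assume uv: "u \<in> verts G" "v \<in> verts G" "(level \<pi> u, level \<pi> v) \<in> snd \<pi>"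
    show "f (level \<pi> u) \<le> f (level \<pi> v)"
    proof (cases "level \<pi> u = level \<pi> v")
      case False
      \<comment> \<open>The level of \<open>v\<close> lies strictly above that of \<open>u\<close>,
        so the ghost arrow from the former to the latter has weight 0, and its inequality is the
        monotonicity sought.\<close>
      have "\<not> level_less \<pi> (level \<pi> v) (level \<pi> u)"
        using False level_le_antisym[OF level_structure uv(3)] by (auto simp: level_less_def)
      then show ?thesis
        using f[of "Inr (level \<pi> v, level \<pi> u)"] False uv level_mem(1)[OF level_structure]
        by (simp add: ghost_graph_def level_graph_def not_ascending_def arrow_weight_def)
    qed simp
  qed
  then show "\<exists>h. potential G arev s \<pi> l h" by blast
next
  fix h assume l: "l \<in> nonneg_lengths G arev" and h: "potential G arev s \<pi> l h"
  \<comment> \<open>The potential is constant on each level, since the order constraints hold both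
    ways there; any representative therefore gives the same value.\<close>
  define f where "f p = h (SOME v. v \<in> p)" for p
  have f: "f (level \<pi> v) = h v" if v: "v \<in> verts G" for v
  proof -
    define w where "w = (SOME w. w \<in> level \<pi> v)"
    have w: "w \<in> level \<pi> v"
      unfolding w_def using level_mem(2)[OF level_structure v] by (rule someI)
    have "w \<in> verts G"
      using w level_mem(1)[OF level_structure v] level_structure
      by (auto simp: level_structure_def partition_on_def)
    moreover have "level \<pi> w = level \<pi> v"
      by (rule level_eq[OF level_structure level_mem(1)[OF level_structure v] w])
    ultimately have "h w \<le> h v" "h v \<le> h w"
      using level_le_refl[OF level_structure level_mem(1)[OF level_structure v]] v
      by (auto intro!: potential_mono[OF h])
    then show ?thesis by (simp add: f_def w_def)
  qed
  have weight_le: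
    "arrow_weight arev s l x \<le> f (tail (ghost_graph G \<pi>) x) - f (head (ghost_graph G \<pi>) x)"
    if x: "x \<in> arcs (ghost_graph G \<pi>) \<inter> not_ascending \<pi>" for x
  proof (cases x)
    case (Inl a)
    then have "a \<in> arcs G" using x by (auto simp: ghost_graph_def level_graph_def)
    then show ?thesis
      using potential_arrow[OF h, of a] Inl
      by (simp add: ghost_graph_def level_graph_def arrow_weight_def f)
  next
    case (Inr y)
    obtain p q where y: "y = (p, q)" by (cases y)
    then have pq: "p \<in> fst \<pi>" "q \<in> fst \<pi>" "p \<noteq> q" "\<not> level_less \<pi> p q"
      using x Inr by (auto simp: ghost_graph_def level_graph_def not_ascending_def)
    then have "(q, p) \<in> snd \<pi>"
      using level_le_total[OF level_structure pq(1,2)] by (auto simp: level_less_def)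
    moreover obtain u where "u \<in> verts G" "level \<pi> u = p"
      by (rule level_part[OF level_structure pq(1)])
    moreover obtain v where "v \<in> verts G" "level \<pi> v = q"
      by (rule level_part[OF level_structure pq(2)])
    ultimately have "f q \<le> f p"
      using potential_mono[OF h, of v u] f by auto
    then show ?thesis
      by (simp add: Inr y ghost_graph_def level_graph_def arrow_weight_def)
  qed
  have "sum_list (map (arrow_weight arev s l) p) \<le> 0"
    if p: "ghost.cycle p" "set p \<subseteq> not_ascending \<pi>" for p
  proof -
    obtain u where "ghost.awalk u p u" using p(1) by (auto simp: ghost.cycle_def)
    from ghost.sum_list_awalk_le_potential[OF weight_le this p(2)] show ?thesis by simp
  qed
  with l show "l \<in> cone_C G arev s \<pi>" by (simp add: cone_C_eq)
qed

text \<open>The description by cycles is an intersection of closed half-spaces and hyperplanes. The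
  one by potentials would present the cone as a projection, whose closedness is less
  immediate.\<close>

lemma closed_cone_C: "closed (cone_C G arev s \<pi>)"
proof -
  have "continuous_on UNIV (\<lambda>l. arrow_weight arev s l x)" for x :: "'b + 'v set \<times> 'v set"
    by (cases x) (auto simp: arrow_weight_def intro!: continuous_intros)
  then have cont: "continuous_on UNIV (\<lambda>l. \<Sum>x\<leftarrow>p. arrow_weight arev s l x)"
    for p :: "('b + 'v set \<times> 'v set) list"
    by (induction p) (auto intro!: continuous_intros)
  have "cone_C G arev s \<pi> =
      (\<Inter>e\<in>edges G arev. {l. 0 \<le> l $ e}) \<inter> (\<Inter>e\<in>- edges G arev. {l. l $ e = 0}) \<inter>
      (\<Inter>p\<in>{p. ghost.cycle p \<and> set p \<subseteq> not_ascending \<pi>}.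
        {l. (\<Sum>x\<leftarrow>p. arrow_weight arev s l x) \<le> 0})"
    by (auto simp: cone_C_eq nonneg_lengths_def)
  also have "closed \<dots>"
    by (intro closed_Int closed_INT ballI closed_Collect_le closed_Collect_eq cont continuous_intros)
  finally show ?thesis .
qed

section \<open>Comparison with the closure of the open cone\<close>

lemma open_sigma_cone_subset: "open_sigma_cone G arev s \<pi> \<subseteq> cone_C G arev s \<pi>"
proof
  fix l assume "l \<in> open_sigma_cone G arev s \<pi>"
  then obtain h where l: "l \<in> pos_lengths G arev"
    and s: "\<And>a. a \<in> arcs G \<Longrightarrow> slope_of G arev l h a = s a" and \<pi>: "levels_of G h = \<pi>"
    by (auto simp: open_sigma_cone_def)
  have "potential G arev s \<pi> l h"
  proof (rule potentialI)
    fix a assume a: "a \<in> arcs G"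
    then have "0 < l $ edge arev a" using l by (auto simp: pos_lengths_def edges_def)
    moreover have "of_int (s a) \<le> (h (tail G a) - h (head G a)) / l $ edge arev a"
      unfolding s[OF a, symmetric] slope_of_def by (rule of_int_floor_le)
    ultimately show "l $ edge arev a * of_int (s a) \<le> h (tail G a) - h (head G a)"
      by (simp add: field_simps)
  next
    fix u v assume "u \<in> verts G" "v \<in> verts G" "(level \<pi> u, level \<pi> v) \<in> snd \<pi>"
    then show "h u \<le> h v" using levels_of_le_iff[of u G v h] \<pi> by simp
  qed
  moreover have "l \<in> nonneg_lengths G arev"
    using l by (auto simp: pos_lengths_def nonneg_lengths_def less_imp_le)
  ultimately show "l \<in> cone_C G arev s \<pi>" by (auto simp: mem_cone_C_iff)
qed

text \<open>The potential of \<open>l\<close> satisfies all inequalities weakly, and the multiple of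
  the witness for \<open>l0\<close> supplies the strict ones that fix the floors and separate the
  levels.\<close>

lemma open_sigma_cone_perturb:
  assumes l: "l \<in> cone_C G arev s \<pi>" and l0: "l0 \<in> open_sigma_cone G arev s \<pi>" and \<epsilon>: "0 < \<epsilon>"
  shows "l + \<epsilon> *\<^sub>R l0 \<in> open_sigma_cone G arev s \<pi>"
proof -
  obtain h where h: "potential G arev s \<pi> l h" and lnn: "l \<in> nonneg_lengths G arev"
    using l by (auto simp: mem_cone_C_iff)
  obtain h0 where l0pos: "l0 \<in> pos_lengths G arev"
    and s: "\<And>a. a \<in> arcs G \<Longrightarrow> slope_of G arev l0 h0 a = s a" and \<pi>: "levels_of G h0 = \<pi>"
    using l0 by (auto simp: open_sigma_cone_def)
  define k where "k v = h v + \<epsilon> * h0 v" for v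
  have pos: "l + \<epsilon> *\<^sub>R l0 \<in> pos_lengths G arev"
    using lnn l0pos \<epsilon> by (auto simp: pos_lengths_def nonneg_lengths_def add_nonneg_pos)
  have "slope_of G arev (l + \<epsilon> *\<^sub>R l0) k a = s a" if a: "a \<in> arcs G" for a
  proof -
    define d where "d = h (tail G a) - h (head G a)"
    define d0 where "d0 = h0 (tail G a) - h0 (head G a)"
    define x where "x = l $ edge arev a"
    define y where "y = l0 $ edge arev a"
    have "edge arev a \<in> edges G arev" using a by (auto simp: edges_def)
    then have x: "0 \<le> x" and y: "0 < y"
      using lnn l0pos by (auto simp: x_def y_def nonneg_lengths_def pos_lengths_def)
    have "of_int (s a) = real_of_int \<lfloor>d0 / y\<rfloor>"
      using s[OF a] by (simp add: slope_of_def d0_def y_def)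
    then have "of_int (s a) \<le> d0 / y" "d0 / y < of_int (s a) + 1" by linarith+
    then have "y * of_int (s a) \<le> d0" "d0 < y * (of_int (s a) + 1)"
      using y by (auto simp: field_simps)
    then have d0: "\<epsilon> * (y * of_int (s a)) \<le> \<epsilon> * d0" "\<epsilon> * d0 < \<epsilon> * (y * (of_int (s a) + 1))"
      using \<epsilon> by (simp_all only: mult_le_cancel_left_pos mult_less_cancel_left_pos)
    have d: "x * of_int (s a) \<le> d"
      using potential_arrow[OF h a] by (simp add: x_def d_def)
    \<comment> \<open>The reversed arrow bounds \<open>d\<close> from above, but only weakly;
      strictness comes from \<open>d0\<close>.\<close>
    have "x * of_int (-1 - s a) \<le> x * of_int (s (arev a))"
      using slope_sum(2)[OF a] by (intro mult_left_mono x) simp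
    also have "\<dots> \<le> - d"
      using potential_arrow[OF h, of "arev a"] a by (simp add: x_def d_def)
    finally have "d \<le> x * (of_int (s a) + 1)" by (simp add: algebra_simps)
    with d d0 have "(x + \<epsilon> * y) * of_int (s a) \<le> d + \<epsilon> * d0"
      "d + \<epsilon> * d0 < (x + \<epsilon> * y) * (of_int (s a) + 1)"
      by (auto simp: algebra_simps)
    moreover have "0 < x + \<epsilon> * y" using x y \<epsilon> by (simp add: add_nonneg_pos)
    ultimately have "\<lfloor>(d + \<epsilon> * d0) / (x + \<epsilon> * y)\<rfloor> = s a"
      by (intro floor_unique) (simp_all add: pos_le_divide_eq pos_divide_less_eq mult.commute)
    moreover have "k (tail G a) - k (head G a) = d + \<epsilon> * d0"
      by (simp add: k_def d_def d0_def algebra_simps)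
    ultimately show ?thesis by (simp add: slope_of_def x_def y_def)
  qed
  moreover have "levels_of G k = \<pi>"
  proof (rule levels_of_eqI[OF level_structure])
    fix u v assume uv: "u \<in> verts G" "v \<in> verts G"
    have iff: "(level \<pi> u, level \<pi> v) \<in> snd \<pi> \<longleftrightarrow> h0 u \<le> h0 v"
      using levels_of_le_iff[OF uv, of h0] \<pi> by simp
    show "(level \<pi> u, level \<pi> v) \<in> snd \<pi> \<longleftrightarrow> k u \<le> k v"
    proof (cases "(level \<pi> u, level \<pi> v) \<in> snd \<pi>")
      case True
      with iff potential_mono[OF h uv True] \<epsilon> show ?thesis by (simp add: k_def add_mono)
    next
      case False
      then have "(level \<pi> v, level \<pi> u) \<in> snd \<pi>"
        using level_le_total[OF level_structure] level_mem(1)[OF level_structure] uv by blast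
      then have "h v \<le> h u" by (rule potential_mono[OF h uv(2,1)])
      \<comment> \<open>Distinct levels may have equal heights under \<open>h\<close>;
        \<open>h0\<close> separates them.\<close>
      moreover have "\<epsilon> * h0 v < \<epsilon> * h0 u" using False iff \<epsilon> by simp
      ultimately show ?thesis using False by (simp add: k_def)
    qed
  qed
  ultimately show ?thesis using pos by (auto simp: open_sigma_cone_def)
qed

lemma sigma_cone_eq_cone_C:
  assumes "open_sigma_cone G arev s \<pi> \<noteq> {}"
  shows "sigma_cone G arev s \<pi> = cone_C G arev s \<pi>"
proof
  show "sigma_cone G arev s \<pi> \<subseteq> cone_C G arev s \<pi>"
    unfolding sigma_cone_def by (rule closure_minimal[OF open_sigma_cone_subset closed_cone_C])
  obtain l0 where l0: "l0 \<in> open_sigma_cone G arev s \<pi>" using assms by blast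
  show "cone_C G arev s \<pi> \<subseteq> sigma_cone G arev s \<pi>"
  proof
    fix l assume l: "l \<in> cone_C G arev s \<pi>"
    have "\<exists>y\<in>open_sigma_cone G arev s \<pi>. dist y l < e" if e: "0 < e" for e
    proof -
      \<comment> \<open>This keeps the norm of the perturbation below \<open>e\<close>. The summand
        1 covers \<open>l0 = 0\<close>, which occurs for a graph without edges.\<close>
      define \<epsilon> where "\<epsilon> = e / (norm l0 + 1)"
      have n: "0 < norm l0 + 1" by (simp add: add_nonneg_pos)
      have "0 < \<epsilon>" using e n by (simp add: \<epsilon>_def)
      moreover have "dist (l + \<epsilon> *\<^sub>R l0) l < e"
        using e n \<open>0 < \<epsilon>\<close> by (simp add: dist_norm \<epsilon>_def field_simps)
      ultimately show ?thesis using open_sigma_cone_perturb[OF l l0] by blast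
    qed
    then show "l \<in> sigma_cone G arev s \<pi>"
      by (simp add: sigma_cone_def closure_approachable)
  qed
qed

section \<open>Faces\<close>

text \<open>
  A pair \<open>(l0, h0)\<close> with the fewest tight constraints replaces a relative interior point of the
  face: a midpoint with any other pair would otherwise have fewer tight constraints.
\<close>

lemma face_minimal_potential:
  assumes F: "F face_of cone_C G arev s \<pi>" and pos: "F \<inter> pos_lengths G arev \<noteq> {}"
  obtains l0 h0 where "l0 \<in> F" "l0 \<in> pos_lengths G arev" "potential G arev s \<pi> l0 h0"
    "\<And>l h i. l \<in> F \<Longrightarrow> potential G arev s \<pi> l h \<Longrightarrow> i \<in> constraints G \<pi> \<Longrightarrow>
      slack G arev s l0 h0 i = 0 \<Longrightarrow> slack G arev s l h i = 0"
proof -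
  \<comment> \<open>Pairs are compared, not lengths alone, because different potentials of one
    \<open>l\<close> may be tight at different constraints.\<close>
  define Q where "Q = {(l, h). l \<in> F \<inter> pos_lengths G arev \<and> potential G arev s \<pi> l h}"
  define tight where "tight = (\<lambda>(l, h). {i \<in> constraints G \<pi>. slack G arev s l h i = 0})"
  have fin: "finite (tight x)" for x
    using finite_constraints[OF fin_digraph_axioms] by (auto simp: tight_def split: prod.split)
  have FC: "l \<in> cone_C G arev s \<pi>" if "l \<in> F" for l
    using face_of_imp_subset[OF F] that by blast
  obtain l where "l \<in> F \<inter> pos_lengths G arev" using pos by blast
  moreover from this obtain h where "potential G arev s \<pi> l h"
    using FC[of l] by (auto simp: mem_cone_C_iff)
  ultimately have "(l, h) \<in> Q" by (simp add: Q_def)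
  then obtain x where x: "x \<in> Q" "\<And>y. y \<in> Q \<Longrightarrow> card (tight x) \<le> card (tight y)"
    using ex_has_least_nat[of "\<lambda>x. x \<in> Q" _ "\<lambda>x. card (tight x)"] by blast
  obtain l0 h0 where lh: "x = (l0, h0)" by (cases x)
  have l0: "l0 \<in> F" "l0 \<in> pos_lengths G arev" "potential G arev s \<pi> l0 h0"
    using x(1) by (auto simp: lh Q_def)
  have "tight (l0, h0) \<subseteq> tight (l, h)" if l: "l \<in> F" and h: "potential G arev s \<pi> l h" for l h
  proof -
    define m where "m = (1/2) *\<^sub>R l0 + (1/2) *\<^sub>R l"
    define k where "k v = 1/2 * h0 v + 1/2 * h v" for v
    have slack: "slack G arev s m k i = 1/2 * slack G arev s l0 h0 i + 1/2 * slack G arev s l h i"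
      for i
      unfolding m_def k_def by (rule slack_combination)
    have nn: "0 \<le> slack G arev s l0 h0 i" "0 \<le> slack G arev s l h i" if "i \<in> constraints G \<pi>" for i
      using that l0(3) h by (auto simp: potential_def)
    have "l \<in> nonneg_lengths G arev"
      using FC[OF l] by (simp add: mem_cone_C_iff)
    then have "m \<in> pos_lengths G arev"
      using l0(2) by (auto simp: m_def pos_lengths_def nonneg_lengths_def add_pos_nonneg)
    moreover have "m \<in> F"
      unfolding m_def by (rule convexD[OF face_of_imp_convex[OF F]]) (use l l0 in auto)
    moreover have "potential G arev s \<pi> m k"
      using nn by (simp add: potential_def slack)
    ultimately have "(m, k) \<in> Q" by (simp add: Q_def)
    then have "card (tight (l0, h0)) \<le> card (tight (m, k))" using x(2) lh by blast
    moreover have sub: "tight (m, k) \<subseteq> tight (l0, h0) \<inter> tight (l, h)"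
    proof
      fix i assume "i \<in> tight (m, k)"
      then have i: "i \<in> constraints G \<pi>" "slack G arev s m k i = 0" by (auto simp: tight_def)
      with slack[of i] nn[OF i(1)] have "slack G arev s l0 h0 i = 0" "slack G arev s l h i = 0"
        by linarith+
      with i show "i \<in> tight (l0, h0) \<inter> tight (l, h)" by (simp add: tight_def)
    qed
    \<comment> \<open>The midpoint pair is in \<open>Q\<close>, so its tight set, being contained in
      the minimal one, must equal it.\<close>
    ultimately have "tight (m, k) = tight (l0, h0)" using card_seteq[OF fin] by blast
    with sub show ?thesis by blast
  qed
  with l0 show ?thesis by (intro that[of l0 h0]) (auto simp: tight_def)
qed

end

text \<open>A strict inequality survives small perturbations by continuity, and an equality is left
  unperturbed. For finitely many inequalities one \<epsilon> then works for all.\<close>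

lemma eventually_nonneg_at_right:
  fixes f g :: real
  assumes "0 \<le> f" "f = 0 \<Longrightarrow> g = 0"
  shows "eventually (\<lambda>\<epsilon>. 0 \<le> f + \<epsilon> * g) (at_right 0)"
proof (cases "f = 0")
  case False
  have "((\<lambda>\<epsilon>. f + \<epsilon> * g) \<longlongrightarrow> f + 0 * g) (at_right 0)" by (intro tendsto_intros)
  then have "eventually (\<lambda>\<epsilon>. 0 < f + \<epsilon> * g) (at_right 0)"
    by (rule order_tendstoD(1)) (use assms False in auto)
  then show ?thesis by eventually_elim simp
qed (use assms in auto)

context slope_levels
begin

text \<open>Reading the new pair off from \<open>(l0, h0)\<close> puts \<open>l0\<close> in its open
  cone, so its cone is the closure of that open cone. The properties (F1) to (F3) follow from
  \<open>h0\<close> being a potential for the old pair.\<close>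

lemma face_cone_C:
  assumes F: "F face_of cone_C G arev s \<pi>" and pos: "F \<inter> pos_lengths G arev \<noteq> {}"
  shows "\<exists>s' \<pi>'. slope_level_pair G arev s' \<pi>'
    \<and> F = cone_C G arev s' \<pi>' \<and> cone_C G arev s' \<pi>' = sigma_cone G arev s' \<pi>'
    \<and> coarsening \<pi>' \<pi>
    \<and> slope_le G s s'
    \<and> integer_vertical_edges G arev s \<subseteq> integer_vertical_edges G arev s'"
proof -
  obtain l0 h0 where l0F: "l0 \<in> F" and l0: "l0 \<in> pos_lengths G arev"
    and h0: "potential G arev s \<pi> l0 h0"
    and tight: "\<And>l h i. l \<in> F \<Longrightarrow> potential G arev s \<pi> l h \<Longrightarrow> i \<in> constraints G \<pi> \<Longrightarrow>
      slack G arev s l0 h0 i = 0 \<Longrightarrow> slack G arev s l h i = 0"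
    by (rule face_minimal_potential[OF F pos]) blast
  define s' where "s' = slope_of G arev l0 h0"
  define \<pi>' where "\<pi>' = levels_of G h0"
  have pair': "slope_level_pair G arev s' \<pi>'"
    unfolding s'_def \<pi>'_def by (rule slope_level_pair_slope_of[OF bidirected_digraph_axioms l0])
  interpret P: slope_levels G arev s' \<pi>'
    by unfold_locales (rule pair')
  have le'_iff: "(level \<pi>' u, level \<pi>' v) \<in> snd \<pi>' \<longleftrightarrow> h0 u \<le> h0 v"
    if "u \<in> verts G" "v \<in> verts G" for u v
    unfolding \<pi>'_def using that by (rule levels_of_le_iff)
  have len: "0 < l0 $ edge arev a" if "a \<in> arcs G" for a
    using l0 that by (auto simp: pos_lengths_def edges_def)
  \<comment> \<open>With \<open>s'_le\<close> this says that \<open>s' a\<close> is the largest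
    integer slope that \<open>(l0, h0)\<close> permits on \<open>a\<close>.\<close>
  have s'_ge: "k \<le> s' a" if "a \<in> arcs G"
    "l0 $ edge arev a * of_int k \<le> h0 (tail G a) - h0 (head G a)" for a k
    using that len[of a] by (simp add: s'_def slope_of_def le_floor_iff pos_le_divide_eq mult.commute)
  have s'_le: "l0 $ edge arev a * of_int (s' a) \<le> h0 (tail G a) - h0 (head G a)"
    if "a \<in> arcs G" for a
  proof -
    have "of_int (s' a) \<le> (h0 (tail G a) - h0 (head G a)) / l0 $ edge arev a"
      by (simp add: s'_def slope_of_def)
    then show ?thesis using len[OF that] by (simp add: pos_le_divide_eq mult.commute)
  qed
  have s_le: "s a \<le> s' a" if "a \<in> arcs G" for a
    using s'_ge[OF that potential_arrow[OF h0 that]] .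
  have nonneg: "0 \<le> l $ edge arev a" if "l \<in> nonneg_lengths G arev" "a \<in> arcs G" for l a
    using that by (auto simp: nonneg_lengths_def edges_def)

  have "F \<subseteq> cone_C G arev s' \<pi>'"
  proof
    fix l assume l: "l \<in> F"
    then have "l \<in> cone_C G arev s \<pi>" using face_of_imp_subset[OF F] by blast
    then obtain h where lnn: "l \<in> nonneg_lengths G arev" and h: "potential G arev s \<pi> l h"
      by (auto simp: mem_cone_C_iff)
    have "potential G arev s' \<pi>' l h"
    proof (rule potentialI)
      fix a assume a: "a \<in> arcs G"
      show "l $ edge arev a * of_int (s' a) \<le> h (tail G a) - h (head G a)"
      proof (cases "s' a = s a")
        case True
        then show ?thesis using potential_arrow[OF h a] by simp
      next
        case False
        \<comment> \<open>Here \<open>s a + 1 \<le> s' a\<close>, so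
          \<open>s (arev a) \<ge> -1 - s a \<ge> - s' a\<close>, while
          \<open>s (arev a) \<le> s' (arev a) \<le> - s' a\<close>. Hence the reversed constraint is
          tight at \<open>(l0, h0)\<close> and on all of \<open>F\<close>, which gives the bound
          with \<open>s' a\<close>.\<close>
        have eq: "s (arev a) = - s' a"
          using False s_le[OF a] s_le[of "arev a"] slope_sum(2)[OF a] P.slope_sum(1)[OF a] a
          by simp
        have "slack G arev s l0 h0 (Inl (arev a)) = 0"
          using s'_le[OF a] potential_arrow[OF h0, of "arev a"] a by (simp add: slack_def eq)
        moreover have "Inl (arev a) \<in> constraints G \<pi>" using a by (auto simp: constraints_def)
        ultimately have "slack G arev s l h (Inl (arev a)) = 0" by (intro tight[OF l h])
        then show ?thesis using a by (simp add: slack_def eq)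
      qed
    next
      fix u v assume uv: "u \<in> verts G" "v \<in> verts G" "(level \<pi>' u, level \<pi>' v) \<in> snd \<pi>'"
      show "h u \<le> h v"
      proof (cases "(level \<pi> u, level \<pi> v) \<in> snd \<pi>")
        case True
        then show ?thesis by (rule potential_mono[OF h uv(1,2)])
      next
        case False
        \<comment> \<open>The two orders disagree on \<open>u\<close> and \<open>v\<close> only if
          \<open>h0\<close> merges their levels; the constraint \<open>(v, u)\<close> is then tight
          on \<open>F\<close>.\<close>
        then have vu: "(level \<pi> v, level \<pi> u) \<in> snd \<pi>"
          using level_le_total[OF level_structure] level_mem(1)[OF level_structure] uv by blast
        have "h0 u = h0 v"
          using potential_mono[OF h0 uv(2,1) vu] le'_iff[OF uv(1,2)] uv(3) by simp
        then have "slack G arev s l h (Inr (v, u)) = 0"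
          by (intro tight[OF l h]) (use vu uv in \<open>auto simp: constraints_def slack_def\<close>)
        then show ?thesis by (simp add: slack_def)
      qed
    qed
    with lnn show "l \<in> cone_C G arev s' \<pi>'" by (auto simp: P.mem_cone_C_iff)
  qed

  moreover have "cone_C G arev s' \<pi>' \<subseteq> F"
  proof
    fix l assume "l \<in> cone_C G arev s' \<pi>'"
    then obtain h where lnn: "l \<in> nonneg_lengths G arev" and h: "potential G arev s' \<pi>' l h"
      by (auto simp: P.mem_cone_C_iff)
    \<comment> \<open>The new constraints imply the old ones: slopes only grow, lengths are
      nonnegative, and the order of \<open>\<pi>\<close> is preserved in
      \<open>\<pi>'\<close>.\<close>
    have "potential G arev s \<pi> l h"
    proof (rule potentialI)
      fix a assume a: "a \<in> arcs G"
      have "l $ edge arev a * of_int (s a) \<le> l $ edge arev a * of_int (s' a)"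
        using s_le[OF a] nonneg[OF lnn a] by (intro mult_left_mono) auto
      then show "l $ edge arev a * of_int (s a) \<le> h (tail G a) - h (head G a)"
        using potential_arrow[OF h a] by simp
    next
      fix u v assume uv: "u \<in> verts G" "v \<in> verts G" "(level \<pi> u, level \<pi> v) \<in> snd \<pi>"
      then show "h u \<le> h v"
        using potential_mono[OF h0 uv] le'_iff[OF uv(1,2)] potential_mono[OF h uv(1,2)] by simp
    qed
    with lnn have lC: "l \<in> cone_C G arev s \<pi>" by (auto simp: mem_cone_C_iff)
    have slack_zero: "slack G arev s l h i = 0"
      if i: "i \<in> constraints G \<pi>" and zero: "slack G arev s l0 h0 i = 0" for i
    proof (cases i)
      case (Inl a)
      then have a: "a \<in> arcs G" using i by (auto simp: constraints_def)
      \<comment> \<open>Tightness makes the quotient defining the slope an integer, so no rounding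
        occurs on either arrow. The new constraints on the two arrows then force equality for
        \<open>(l, h)\<close>.\<close>
      have "s' a = s a" "s' (arev a) = - s a"
        using s_le[OF a] s'_ge[of "arev a" "- s a"] zero P.slope_sum(1)[OF a] a Inl
        by (auto simp: slack_def)
      then show ?thesis
        using potential_arrow[OF h a] potential_arrow[OF h, of "arev a"] a
        by (simp add: Inl slack_def)
    next
      case (Inr y)
      obtain u v where y: "y = (u, v)" by (cases y)
      have uv: "u \<in> verts G" "v \<in> verts G" using i by (auto simp: Inr y constraints_def)
      have "h0 u = h0 v" using zero by (simp add: Inr y slack_def)
      then show ?thesis
        using potential_mono[OF h uv] potential_mono[OF h uv(2,1)] le'_iff uv
        by (simp add: Inr y slack_def)
    qed
    \<comment> \<open>These are the slacks of the pair obtained by moving from \<open>(l, h)\<close>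
      past \<open>(l0, h0)\<close>. By \<open>slack_zero\<close> those that vanish at
      \<open>(l0, h0)\<close> stay 0.\<close>
    have "\<forall>\<^sub>F \<epsilon> in at_right 0. \<forall>i\<in>constraints G \<pi>.
        0 \<le> slack G arev s l0 h0 i + \<epsilon> * (slack G arev s l0 h0 i - slack G arev s l h i)"
      using h0 slack_zero finite_constraints[OF fin_digraph_axioms]
      by (intro eventually_ball_finite ballI eventually_nonneg_at_right) (auto simp: potential_def)
    moreover have "\<forall>\<^sub>F \<epsilon> in at_right 0. \<forall>e\<in>edges G arev. 0 \<le> l0 $ e + \<epsilon> * (l0 $ e - l $ e)"
      using l0 by (intro eventually_ball_finite ballI eventually_nonneg_at_right)
        (auto simp: pos_lengths_def less_imp_le)
    moreover have "\<forall>\<^sub>F \<epsilon> in at_right 0. (0::real) < \<epsilon>" by (rule eventually_at_right_less)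
    ultimately have "\<forall>\<^sub>F \<epsilon> in at_right 0. 0 < \<epsilon> \<and>
        (\<forall>i\<in>constraints G \<pi>.
          0 \<le> slack G arev s l0 h0 i + \<epsilon> * (slack G arev s l0 h0 i - slack G arev s l h i)) \<and>
        (\<forall>e\<in>edges G arev. 0 \<le> l0 $ e + \<epsilon> * (l0 $ e - l $ e))"
      by eventually_elim simp
    then obtain \<epsilon> where \<epsilon>: "0 < \<epsilon>"
      "\<And>i. i \<in> constraints G \<pi> \<Longrightarrow>
        0 \<le> slack G arev s l0 h0 i + \<epsilon> * (slack G arev s l0 h0 i - slack G arev s l h i)"
      "\<And>e. e \<in> edges G arev \<Longrightarrow> 0 \<le> l0 $ e + \<epsilon> * (l0 $ e - l $ e)"
      using eventually_happens[of _ "at_right (0::real)"] trivial_limit_at_right_real by blast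
    define z where "z = (1 + \<epsilon>) *\<^sub>R l0 + (- \<epsilon>) *\<^sub>R l"
    define k where "k v = (1 + \<epsilon>) * h0 v + (- \<epsilon>) * h v" for v
    have "potential G arev s \<pi> z k"
      unfolding potential_def z_def k_def slack_combination
      using \<epsilon>(2) by (simp add: algebra_simps)
    moreover have "z \<in> nonneg_lengths G arev"
      using \<epsilon>(3) l0 lnn by (auto simp: z_def nonneg_lengths_def pos_lengths_def algebra_simps)
    ultimately have zC: "z \<in> cone_C G arev s \<pi>" by (auto simp: mem_cone_C_iff)
    show "l \<in> F"
    proof (cases "l = l0")
      case False
      have "(1 + \<epsilon>) *\<^sub>R (l0 - l) = z - l" by (simp add: z_def algebra_simps)
      then have "l \<noteq> z" using False \<epsilon>(1) by auto
      \<comment> \<open>Solving the definition of \<open>z\<close> for \<open>l0\<close> gives its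
        position on the segment from \<open>l\<close> to \<open>z\<close>, at a parameter strictly
        between 0 and 1, as the face property requires.\<close>
      moreover have "l0 = (1 - 1 / (1 + \<epsilon>)) *\<^sub>R l + (1 / (1 + \<epsilon>)) *\<^sub>R z"
      proof -
        have "1 - 1 / (1 + \<epsilon>) = 1 / (1 + \<epsilon>) * \<epsilon>" using \<epsilon>(1) by (simp add: field_simps)
        then have "(1 - 1 / (1 + \<epsilon>)) *\<^sub>R l + (1 / (1 + \<epsilon>)) *\<^sub>R z = (1 / (1 + \<epsilon>)) *\<^sub>R (\<epsilon> *\<^sub>R l + z)"
          by (simp add: scaleR_add_right)
        also have "\<epsilon> *\<^sub>R l + z = (1 + \<epsilon>) *\<^sub>R l0" by (simp add: z_def)
        finally show ?thesis using \<epsilon>(1) by simp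
      qed
      ultimately have "l0 \<in> open_segment l z"
        unfolding in_segment using \<epsilon>(1) by (intro conjI exI[of _ "1 / (1 + \<epsilon>)"]) auto
      then show ?thesis using face_ofD[OF F _ lC zC l0F] by blast
    qed (use l0F in simp)
  qed

  moreover have "l0 \<in> open_sigma_cone G arev s' \<pi>'"
    using l0 by (auto simp: open_sigma_cone_def s'_def \<pi>'_def)
  then have "cone_C G arev s' \<pi>' = sigma_cone G arev s' \<pi>'"
    by (subst P.sigma_cone_eq_cone_C) auto
  moreover have "coarsening \<pi>' \<pi>"
    unfolding \<pi>'_def
    by (rule coarsening_levels_of[OF level_structure]) (rule potential_mono[OF h0])
  moreover have "slope_le G s s'" using s_le by (simp add: slope_le_def)
  moreover have "integer_vertical_edges G arev s \<subseteq> integer_vertical_edges G arev s'"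
  proof
    fix e assume "e \<in> integer_vertical_edges G arev s"
    then obtain a b where e: "e = edge arev a" and a: "a \<in> arcs G" "s a + s (arev a) = 0"
      and b: "b \<in> edge arev a" "b \<in> A_slope G arev s"
      by (auto simp: integer_vertical_edges_def)
    \<comment> \<open>The sum for \<open>s\<close> is already 0, the maximum allowed, so neither
      slope can increase.\<close>
    have "s' a = s a" "s' (arev a) = s (arev a)"
      using a s_le[OF a(1)] s_le[of "arev a"] P.slope_sum(1)[OF a(1)] by auto
    then have "b \<in> A_slope G arev s'" "s' a + s' (arev a) = 0"
      using a b by (auto simp: A_slope_def edge_def)
    then show "e \<in> integer_vertical_edges G arev s'"
      unfolding integer_vertical_edges_def using e a b by blast
  qed
  ultimately show ?thesis using pair' by blast
qed

end

theorem theorem9p11: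
  fixes G :: "('v, 'b::finite) pre_digraph"
    and arev :: "'b \<Rightarrow> 'b"
    and s :: "'b \<Rightarrow> int"
    and \<pi> :: "'v levels"
  assumes "bidirected_digraph G arev"
    and "fin_digraph G"
    and "Digraph_Component.connected G"
    and "slope_level_pair G arev s \<pi>"
  shows "(\<forall>F. F face_of cone_C G arev s \<pi> \<and> F \<inter> pos_lengths G arev \<noteq> {} \<longrightarrow>
            (\<exists>s' \<pi>'. slope_level_pair G arev s' \<pi>'
               \<and> F = cone_C G arev s' \<pi>' \<and> cone_C G arev s' \<pi>' = sigma_cone G arev s' \<pi>'
               \<and> coarsening \<pi>' \<pi>
               \<and> slope_le G s s'
               \<and> integer_vertical_edges G arev s \<subseteq> integer_vertical_edges G arev s'))
       \<and> (open_sigma_cone G arev s \<pi> \<noteq> {} \<longrightarrow>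
            (\<forall>F. F face_of sigma_cone G arev s \<pi> \<and> F \<inter> pos_lengths G arev \<noteq> {} \<longrightarrow>
               (\<exists>s' \<pi>'. slope_level_pair G arev s' \<pi>'
                  \<and> F = sigma_cone G arev s' \<pi>'
                  \<and> coarsening \<pi>' \<pi>
                  \<and> slope_le G s s'
                  \<and> integer_vertical_edges G arev s \<subseteq> integer_vertical_edges G arev s')))"
proof -
  interpret slope_levels G arev s \<pi>
    using assms by (simp add: slope_levels_def slope_levels_axioms_def)
  \<comment> \<open>A nonempty open cone makes its closure equal to
    \<open>cone_C G arev s \<pi>\<close>, so the second claim is an instance of the first.\<close>
  show ?thesis
    using face_cone_C sigma_cone_eq_cone_C by metis
qed

end
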